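(* Let $(t:A\otimes A\to A\otimes A,\ e:A\to I)$ be a counital fusion morphism in a braided monoidal category $\mathcal C$. Its category of comodules is monoidal in such a way that the evident forgetful functor to $\mathcal C$, $(V,v)\mapsto V$, is strict monoidal.
   Context: Conventions: $\otimes$ is the monoidal product, $I$ the unit, $b_{X,Y}:X\otimes Y\to Y\otimes X$ the braiding; composition is juxtaposition, $1$ denotes identities, associativity and unit isomorphisms are suppressed. A *counital fusion morphism* in $\mathcal C$ is a pair of morphisms $t:A\otimes A\to A\otimes A$ and $e:A\to I$ such that $(t\otimes 1)(b^{-1}\otimes 1)(1\otimes t)(b\otimes 1)(1\otimes t)=(1\otimes t)(t\otimes 1)$ on $A^{\otimes 3}$ (with $b=b_{A,A}$) and $(1\otimes e)t=1\otimes e$. A *comodule* over $(t,e)$ is an object $V$ with a morphism $v:V\otimes A\to V\otimes A$ such that - $(v\otimes 1)(b_{V,A}^{-1}\otimes 1)(1\otimes v)(b_{V,A}\otimes 1)(1\otimes t)=(1\otimes t)(v\otimes 1)$ on $V\otimes A\otimes A$; - $(1\otimes e)v=1\otimes e:V\otimes A\to V$. A *morphism* of comodules $(V,v)\to(W,w)$ is a morphism $f:V\to W$ in $\mathcal C$ with $w(f\otimes 1)=(f\otimes 1)v$. *)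

theory Defs
  imports Main
begin

section \<open>Categories\<close>

record ('o, 'm) category =
  Obj :: "'o set"
  Arr :: "'m set"
  Dom :: "'m \<Rightarrow> 'o"
  Cod :: "'m \<Rightarrow> 'o"
  Id :: "'o \<Rightarrow> 'm" ("\<one>\<index>")
  Comp :: "'m \<Rightarrow> 'm \<Rightarrow> 'm" (infixr "\<cdot>\<index>" 60)

definition homset :: "('o, 'm, 'z) category_scheme \<Rightarrow> 'o \<Rightarrow> 'o \<Rightarrow> 'm set" ("hom\<index>") where
  "hom\<^bsub>C\<^esub> X Y = {f \<in> Arr C. Dom C f = X \<and> Cod C f = Y}"

definition inverse_arrows :: "('o, 'm, 'z) category_scheme \<Rightarrow> 'm \<Rightarrow> 'm \<Rightarrow> bool" where
  "inverse_arrows C f g \<longleftrightarrow>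
     f \<in> Arr C \<and> g \<in> hom\<^bsub>C\<^esub> (Cod C f) (Dom C f) \<and>
     g \<cdot>\<^bsub>C\<^esub> f = \<one>\<^bsub>C\<^esub> (Dom C f) \<and> f \<cdot>\<^bsub>C\<^esub> g = \<one>\<^bsub>C\<^esub> (Cod C f)"

definition is_iso :: "('o, 'm, 'z) category_scheme \<Rightarrow> 'm \<Rightarrow> bool" where
  "is_iso C f \<longleftrightarrow> (\<exists>g. inverse_arrows C f g)"

definition inv_arr :: "('o, 'm, 'z) category_scheme \<Rightarrow> 'm \<Rightarrow> 'm" where
  "inv_arr C f = (THE g. inverse_arrows C f g)"

locale category =
  fixes C (structure)
  assumes dom_obj: "f \<in> Arr C \<Longrightarrow> Dom C f \<in> Obj C"
    and cod_obj: "f \<in> Arr C \<Longrightarrow> Cod C f \<in> Obj C"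
    and id_hom: "X \<in> Obj C \<Longrightarrow> \<one> X \<in> hom X X"
    and comp_hom: "\<lbrakk>f \<in> hom X Y; g \<in> hom Y Z\<rbrakk> \<Longrightarrow> g \<cdot> f \<in> hom X Z"
    and comp_id_left: "f \<in> hom X Y \<Longrightarrow> \<one> Y \<cdot> f = f"
    and comp_id_right: "f \<in> hom X Y \<Longrightarrow> f \<cdot> \<one> X = f"
    and comp_assoc: "\<lbrakk>f \<in> hom X Y; g \<in> hom Y Z; h \<in> hom Z W\<rbrakk> \<Longrightarrow> (h \<cdot> g) \<cdot> f = h \<cdot> (g \<cdot> f)"

locale cat_functor =
  source: category C + target: category D
  for C :: "('o, 'm, 'y) category_scheme" and D :: "('p, 'n, 'z) category_scheme" +
  fixes Fo :: "'o \<Rightarrow> 'p" and Fa :: "'m \<Rightarrow> 'n"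
  assumes map_obj: "X \<in> Obj C \<Longrightarrow> Fo X \<in> Obj D"
    and map_hom: "f \<in> hom\<^bsub>C\<^esub> X Y \<Longrightarrow> Fa f \<in> hom\<^bsub>D\<^esub> (Fo X) (Fo Y)"
    and map_id: "X \<in> Obj C \<Longrightarrow> Fa (\<one>\<^bsub>C\<^esub> X) = \<one>\<^bsub>D\<^esub> (Fo X)"
    and map_comp: "\<lbrakk>f \<in> hom\<^bsub>C\<^esub> X Y; g \<in> hom\<^bsub>C\<^esub> Y Z\<rbrakk> \<Longrightarrow> Fa (g \<cdot>\<^bsub>C\<^esub> f) = Fa g \<cdot>\<^bsub>D\<^esub> Fa f"


section \<open>Monoidal and braided monoidal categories\<close>

text \<open>The tensor product is written \<open>\<odot>\<close> on objects and \<open>\<otimes>\<close> on arrows.\<close>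

record ('o, 'm) monoidal_category = "('o, 'm) category" +
  Tensor_obj :: "'o \<Rightarrow> 'o \<Rightarrow> 'o" (infixr "\<odot>\<index>" 75)
  Tensor_arr :: "'m \<Rightarrow> 'm \<Rightarrow> 'm" (infixr "\<otimes>\<index>" 70)
  Unit :: "'o" ("\<I>\<index>")
  Assoc :: "'o \<Rightarrow> 'o \<Rightarrow> 'o \<Rightarrow> 'm" ("\<a>\<index>")
  Lunit :: "'o \<Rightarrow> 'm" ("\<l>\<index>")
  Runit :: "'o \<Rightarrow> 'm" ("\<r>\<index>")

locale monoidal_category = category C
  for C (structure) +
  assumes tensor_obj: "\<lbrakk>X \<in> Obj C; Y \<in> Obj C\<rbrakk> \<Longrightarrow> X \<odot> Y \<in> Obj C"
    and tensor_hom: "\<lbrakk>f \<in> hom X Y; g \<in> hom X' Y'\<rbrakk> \<Longrightarrow> f \<otimes> g \<in> hom (X \<odot> X') (Y \<odot> Y')"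
    and tensor_id: "\<lbrakk>X \<in> Obj C; Y \<in> Obj C\<rbrakk> \<Longrightarrow> \<one> X \<otimes> \<one> Y = \<one> (X \<odot> Y)"
    and interchange:
      "\<lbrakk>f \<in> hom X Y; g \<in> hom Y Z; f' \<in> hom X' Y'; g' \<in> hom Y' Z'\<rbrakk>
        \<Longrightarrow> (g \<otimes> g') \<cdot> (f \<otimes> f') = (g \<cdot> f) \<otimes> (g' \<cdot> f')"
    and unit_obj: "\<I> \<in> Obj C"
    and assoc_hom: "\<lbrakk>X \<in> Obj C; Y \<in> Obj C; Z \<in> Obj C\<rbrakk>
        \<Longrightarrow> \<a> X Y Z \<in> hom ((X \<odot> Y) \<odot> Z) (X \<odot> (Y \<odot> Z))"
    and assoc_iso: "\<lbrakk>X \<in> Obj C; Y \<in> Obj C; Z \<in> Obj C\<rbrakk> \<Longrightarrow> is_iso C (\<a> X Y Z)"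
    and assoc_natural: "\<lbrakk>f \<in> hom X X'; g \<in> hom Y Y'; h \<in> hom Z Z'\<rbrakk>
        \<Longrightarrow> \<a> X' Y' Z' \<cdot> ((f \<otimes> g) \<otimes> h) = (f \<otimes> (g \<otimes> h)) \<cdot> \<a> X Y Z"
    and lunit_hom: "X \<in> Obj C \<Longrightarrow> \<l> X \<in> hom (\<I> \<odot> X) X"
    and lunit_iso: "X \<in> Obj C \<Longrightarrow> is_iso C (\<l> X)"
    and lunit_natural: "f \<in> hom X Y \<Longrightarrow> \<l> Y \<cdot> (\<one> \<I> \<otimes> f) = f \<cdot> \<l> X"
    and runit_hom: "X \<in> Obj C \<Longrightarrow> \<r> X \<in> hom (X \<odot> \<I>) X"
    and runit_iso: "X \<in> Obj C \<Longrightarrow> is_iso C (\<r> X)"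
    and runit_natural: "f \<in> hom X Y \<Longrightarrow> \<r> Y \<cdot> (f \<otimes> \<one> \<I>) = f \<cdot> \<r> X"
    and pentagon: "\<lbrakk>X \<in> Obj C; Y \<in> Obj C; Z \<in> Obj C; W \<in> Obj C\<rbrakk>
        \<Longrightarrow> (\<one> X \<otimes> \<a> Y Z W) \<cdot> \<a> X (Y \<odot> Z) W \<cdot> (\<a> X Y Z \<otimes> \<one> W)
            = \<a> X Y (Z \<odot> W) \<cdot> \<a> (X \<odot> Y) Z W"
    and triangle: "\<lbrakk>X \<in> Obj C; Y \<in> Obj C\<rbrakk>
        \<Longrightarrow> (\<one> X \<otimes> \<l> Y) \<cdot> \<a> X \<I> Y = \<r> X \<otimes> \<one> Y"

locale strict_monoidal_functor =
  cat_functor C D Fo Fa + source: monoidal_category C + target: monoidal_category D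
  for C :: "('o, 'm, 'y) monoidal_category_scheme"
    and D :: "('p, 'n, 'z) monoidal_category_scheme"
    and Fo :: "'o \<Rightarrow> 'p" and Fa :: "'m \<Rightarrow> 'n" +
  assumes map_tensor_obj:
      "\<lbrakk>X \<in> Obj C; Y \<in> Obj C\<rbrakk> \<Longrightarrow> Fo (X \<odot>\<^bsub>C\<^esub> Y) = Fo X \<odot>\<^bsub>D\<^esub> Fo Y"
    and map_tensor_arr:
      "\<lbrakk>f \<in> Arr C; g \<in> Arr C\<rbrakk> \<Longrightarrow> Fa (f \<otimes>\<^bsub>C\<^esub> g) = Fa f \<otimes>\<^bsub>D\<^esub> Fa g"
    and map_unit: "Fo \<I>\<^bsub>C\<^esub> = \<I>\<^bsub>D\<^esub>"
    and map_assoc: "\<lbrakk>X \<in> Obj C; Y \<in> Obj C; Z \<in> Obj C\<rbrakk>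
        \<Longrightarrow> Fa (\<a>\<^bsub>C\<^esub> X Y Z) = \<a>\<^bsub>D\<^esub> (Fo X) (Fo Y) (Fo Z)"
    and map_lunit: "X \<in> Obj C \<Longrightarrow> Fa (\<l>\<^bsub>C\<^esub> X) = \<l>\<^bsub>D\<^esub> (Fo X)"
    and map_runit: "X \<in> Obj C \<Longrightarrow> Fa (\<r>\<^bsub>C\<^esub> X) = \<r>\<^bsub>D\<^esub> (Fo X)"

record ('o, 'm) braided_monoidal_category = "('o, 'm) monoidal_category" +
  Braid :: "'o \<Rightarrow> 'o \<Rightarrow> 'm" ("\<b>\<index>")

locale braided_monoidal_category = monoidal_category C
  for C (structure) +
  assumes braid_hom: "\<lbrakk>X \<in> Obj C; Y \<in> Obj C\<rbrakk> \<Longrightarrow> \<b> X Y \<in> hom (X \<odot> Y) (Y \<odot> X)"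
    and braid_iso: "\<lbrakk>X \<in> Obj C; Y \<in> Obj C\<rbrakk> \<Longrightarrow> is_iso C (\<b> X Y)"
    and braid_natural: "\<lbrakk>f \<in> hom X X'; g \<in> hom Y Y'\<rbrakk>
        \<Longrightarrow> \<b> X' Y' \<cdot> (f \<otimes> g) = (g \<otimes> f) \<cdot> \<b> X Y"
    and hexagon1: "\<lbrakk>X \<in> Obj C; Y \<in> Obj C; Z \<in> Obj C\<rbrakk>
        \<Longrightarrow> \<a> Y Z X \<cdot> \<b> X (Y \<odot> Z) \<cdot> \<a> X Y Z
            = (\<one> Y \<otimes> \<b> X Z) \<cdot> \<a> Y X Z \<cdot> (\<b> X Y \<otimes> \<one> Z)"
    and hexagon2: "\<lbrakk>X \<in> Obj C; Y \<in> Obj C; Z \<in> Obj C\<rbrakk>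
        \<Longrightarrow> inv_arr C (\<a> Z X Y) \<cdot> \<b> (X \<odot> Y) Z \<cdot> inv_arr C (\<a> X Y Z)
            = (\<b> X Z \<otimes> \<one> Y) \<cdot> inv_arr C (\<a> X Z Y) \<cdot> (\<one> X \<otimes> \<b> Y Z)"


section \<open>Counital fusion morphisms and their comodules\<close>

text \<open>
  Triple tensor products are bracketed to the left.  For \<open>f : Y \<odot> Z \<rightarrow> Y \<odot> Z\<close>, the arrow
  usually written \<open>1 \<otimes> f\<close> on \<open>X \<odot> Y \<odot> Z\<close> is therefore the following conjugate by the associator.
\<close>

context
  fixes C :: "('o, 'm, 'z) monoidal_category_scheme" (structure)
begin

definition whisker_left :: "'o \<Rightarrow> 'o \<Rightarrow> 'o \<Rightarrow> 'm \<Rightarrow> 'm" where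
  "whisker_left X Y Z f = inv_arr C (\<a> X Y Z) \<cdot> (\<one> X \<otimes> f) \<cdot> \<a> X Y Z"

end

context
  fixes C :: "('o, 'm, 'z) braided_monoidal_category_scheme" (structure)
begin

text \<open>
  Both sides of a counit equation \<open>(1 \<otimes> e) v = 1 \<otimes> e\<close> are arrows \<open>V \<odot> A \<rightarrow> V \<odot> \<I>\<close>; the
  invertible arrow \<open>\<r> V\<close> to \<open>V\<close> is left out on both sides.
\<close>

definition counital_fusion_morphism :: "'o \<Rightarrow> 'm \<Rightarrow> 'm \<Rightarrow> bool" where
  "counital_fusion_morphism A t e \<longleftrightarrow>
     A \<in> Obj C \<and> t \<in> hom (A \<odot> A) (A \<odot> A) \<and> e \<in> hom A \<I> \<and>
     (t \<otimes> \<one> A) \<cdot> (inv_arr C (\<b> A A) \<otimes> \<one> A) \<cdot> whisker_left C A A A t \<cdot> (\<b> A A \<otimes> \<one> A) \<cdot>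
         whisker_left C A A A t
       = whisker_left C A A A t \<cdot> (t \<otimes> \<one> A) \<and>
     (\<one> A \<otimes> e) \<cdot> t = \<one> A \<otimes> e"

definition comodule :: "'o \<Rightarrow> 'm \<Rightarrow> 'm \<Rightarrow> 'o \<Rightarrow> 'm \<Rightarrow> bool" where
  "comodule A t e V v \<longleftrightarrow>
     V \<in> Obj C \<and> v \<in> hom (V \<odot> A) (V \<odot> A) \<and>
     (v \<otimes> \<one> A) \<cdot> (inv_arr C (\<b> V A) \<otimes> \<one> A) \<cdot> whisker_left C A V A v \<cdot> (\<b> V A \<otimes> \<one> A) \<cdot>
         whisker_left C V A A t
       = whisker_left C V A A t \<cdot> (v \<otimes> \<one> A) \<and>
     (\<one> V \<otimes> e) \<cdot> v = \<one> V \<otimes> e"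

definition comodule_morphism :: "'o \<Rightarrow> 'o \<times> 'm \<Rightarrow> 'o \<times> 'm \<Rightarrow> 'm \<Rightarrow> bool" where
  "comodule_morphism A P Q f \<longleftrightarrow>
     f \<in> hom (fst P) (fst Q) \<and> snd Q \<cdot> (f \<otimes> \<one> A) = (f \<otimes> \<one> A) \<cdot> snd P"

text \<open>
  The same arrow of \<open>C\<close> may underlie morphisms between different comodules, so an arrow of the
  category of comodules carries its domain and codomain.
\<close>

definition comodule_category ::
    "'o \<Rightarrow> 'm \<Rightarrow> 'm \<Rightarrow>
     ('o \<times> 'm, ('o \<times> 'm) \<times> ('o \<times> 'm) \<times> 'm) category"
    where
  "comodule_category A t e =
     \<lparr> Obj = {(V, v). comodule A t e V v},
       Arr = {(P, Q, f). comodule A t e (fst P) (snd P) \<and> comodule A t e (fst Q) (snd Q) \<and>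
                         comodule_morphism A P Q f},
       Dom = (\<lambda>(P, Q, f). P),
       Cod = (\<lambda>(P, Q, f). Q),
       Id = (\<lambda>P. (P, P, \<one> (fst P))),
       Comp = (\<lambda>(Q, R, g) (P, Q', f). (P, R, g \<cdot> f)) \<rparr>"

end

definition forget_obj :: "'o \<times> 'm \<Rightarrow> 'o" where
  "forget_obj = (\<lambda>(V, v). V)"

definition forget_arr :: "('o \<times> 'm) \<times> ('o \<times> 'm) \<times> 'm \<Rightarrow> 'm" where
  "forget_arr = (\<lambda>(P, Q, f). f)"

end

theory Submission
  imports Defs
begin

text \<open>
  Write an arrow acting on some tensor factors with the positions of these factors as indices, the
  unit isomorphisms and associators being suppressed.  The comodule equation for \<open>(V, v)\<close> then reads
  \<open>v\<^sub>1\<^sub>2 v\<^sub>1\<^sub>3 t\<^sub>2\<^sub>3 = t\<^sub>2\<^sub>3 v\<^sub>1\<^sub>2\<close>, where \<open>v\<^sub>1\<^sub>3\<close> is \<open>1 \<otimes> v\<close> conjugated by the braiding that moves \<open>V\<close>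
  to the right.  The tensor product of \<open>(V, v)\<close> and \<open>(W, w)\<close> is \<open>V \<otimes> W\<close> with \<open>v\<^sub>1\<^sub>3 w\<^sub>2\<^sub>3\<close>, and the
  unit is \<open>I\<close> with the identity of \<open>I \<otimes> A\<close>.  On \<open>V \<otimes> W \<otimes> A \<otimes> A\<close> the comodule equation of the
  tensor product is the computation
  \<open>v\<^sub>1\<^sub>3 w\<^sub>2\<^sub>3 v\<^sub>1\<^sub>4 w\<^sub>2\<^sub>4 t\<^sub>3\<^sub>4 = v\<^sub>1\<^sub>3 v\<^sub>1\<^sub>4 w\<^sub>2\<^sub>3 w\<^sub>2\<^sub>4 t\<^sub>3\<^sub>4 = v\<^sub>1\<^sub>3 v\<^sub>1\<^sub>4 t\<^sub>3\<^sub>4 w\<^sub>2\<^sub>3 = t\<^sub>3\<^sub>4 v\<^sub>1\<^sub>3 w\<^sub>2\<^sub>3\<close>,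
  whose first step holds because the braiding that moves \<open>V\<close> past \<open>W \<otimes> A\<close> is natural in \<open>W \<otimes> A\<close>.

  To carry this out with associators, consider the category of pairs \<open>(V, v)\<close> with \<open>v\<close> any
  endomorphism of \<open>V \<otimes> A\<close> (an operator), and of the arrows \<open>V \<rightarrow> W\<close> that intertwine two operators.
  A factor \<open>W\<close> can be put to the left of \<open>(V, v)\<close>, giving \<open>v\<^sub>2\<^sub>3\<close> on \<open>W \<otimes> V\<close>, or to its right, giving
  \<open>v\<^sub>1\<^sub>3\<close> on \<open>V \<otimes> W\<close>; the second operator is the one that makes the braiding an isomorphism to the
  first.  The associators intertwine the operators obtained by inserting two factors: left of \<open>V\<close>
  by the pentagon (\<open>before_before\<close>), one on each side by one hexagon (\<open>past_before\<close>), and right of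
  \<open>V\<close> by the other hexagon (\<open>past_past\<close>).  All further facts about \<open>v\<^sub>1\<^sub>3\<close> are transported along these
  isomorphisms, using that an equation between operators may be checked after an isomorphism
  (\<open>intertwines_unique\<close>).  In particular the fusion and counit equations pass from \<open>v\<close> to \<open>v\<^sub>2\<^sub>3\<close> and
  \<open>v\<^sub>1\<^sub>3\<close>, and the structure isomorphisms of \<open>C\<close> are comodule morphisms.  Since comodule
  morphisms compose and tensor as in \<open>C\<close>, the axioms of a monoidal category are inherited.
\<close>

section \<open>Arrows and inverses\<close>

context category
begin

lemma hom_iff: "f \<in> hom X Y \<longleftrightarrow> f \<in> Arr C \<and> Dom C f = X \<and> Cod C f = Y"
  by (simp add: homset_def)

lemmas arr_obj [simp] = dom_obj cod_obj

lemma id_arr [simp]: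
  assumes "X \<in> Obj C"
  shows "\<one> X \<in> Arr C" "Dom C (\<one> X) = X" "Cod C (\<one> X) = X"
  using id_hom[OF assms] by (simp_all add: hom_iff)

lemma comp_arr [simp]:
  assumes "f \<in> Arr C" "g \<in> Arr C" "Cod C f = Dom C g"
  shows "g \<cdot> f \<in> Arr C" "Dom C (g \<cdot> f) = Dom C f" "Cod C (g \<cdot> f) = Cod C g"
  using comp_hom[of f "Dom C f" "Dom C g" g "Cod C g"] assms by (simp_all add: hom_iff)

lemma comp_id [simp]:
  assumes "f \<in> Arr C"
  shows "Y = Cod C f \<Longrightarrow> \<one> Y \<cdot> f = f" "X = Dom C f \<Longrightarrow> f \<cdot> \<one> X = f"
  using assms comp_id_left[of f] comp_id_right[of f] by (auto simp: hom_iff)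

lemma assoc_comp [simp]:
  assumes "f \<in> Arr C" "g \<in> Arr C" "h \<in> Arr C" "Cod C f = Dom C g" "Cod C g = Dom C h"
  shows "(h \<cdot> g) \<cdot> f = h \<cdot> (g \<cdot> f)"
  using assms by (intro comp_assoc) (auto simp: hom_iff)

lemma inverse_arrows_unique:
  assumes "inverse_arrows C f g" "inverse_arrows C f g'"
  shows "g = g'"
proof -
  have "g = g \<cdot> (f \<cdot> g')"
    using assms by (simp add: inverse_arrows_def hom_iff)
  also have "\<dots> = (g \<cdot> f) \<cdot> g'"
    using assms by (intro assoc_comp[symmetric]) (simp_all add: inverse_arrows_def hom_iff)
  also have "\<dots> = g'"
    using assms by (simp add: inverse_arrows_def hom_iff)
  finally show ?thesis .
qed

lemma inverse_inv_arr: "is_iso C f \<Longrightarrow> inverse_arrows C f (inv_arr C f)"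
  unfolding is_iso_def inv_arr_def by (metis theI inverse_arrows_unique)

lemma inv_arr_simps [simp]:
  assumes "is_iso C f"
  shows "inv_arr C f \<in> Arr C" "Dom C (inv_arr C f) = Cod C f" "Cod C (inv_arr C f) = Dom C f"
    "inv_arr C f \<cdot> f = \<one> (Dom C f)" "f \<cdot> inv_arr C f = \<one> (Cod C f)"
  using inverse_inv_arr[OF assms] by (auto simp: inverse_arrows_def hom_iff)

lemma iso_arr [simp]: "is_iso C f \<Longrightarrow> f \<in> Arr C"
  by (auto simp: is_iso_def inverse_arrows_def)

lemma inv_arr_cancel [simp]:
  assumes "is_iso C f" "h \<in> Arr C"
  shows "Cod C h = Dom C f \<Longrightarrow> inv_arr C f \<cdot> (f \<cdot> h) = h"
    "Cod C h = Cod C f \<Longrightarrow> f \<cdot> (inv_arr C f \<cdot> h) = h"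
  using assms by (simp_all flip: assoc_comp)

lemma is_isoI:
  assumes "f \<in> hom X Y" "g \<in> hom Y X" "g \<cdot> f = \<one> X" "f \<cdot> g = \<one> Y"
  shows "is_iso C f"
  using assms unfolding is_iso_def inverse_arrows_def by (auto simp: hom_iff)

lemma is_iso_id [simp]: "X \<in> Obj C \<Longrightarrow> is_iso C (\<one> X)"
  by (rule is_isoI[of _ X X "\<one> X"]) (simp_all add: hom_iff)

lemma is_iso_inv [simp]: "is_iso C f \<Longrightarrow> is_iso C (inv_arr C f)"
  by (rule is_isoI[of _ "Cod C f" "Dom C f" f]) (auto simp: hom_iff)

lemma is_iso_comp [simp]:
  assumes "is_iso C f" "is_iso C g" "Cod C f = Dom C g"
  shows "is_iso C (g \<cdot> f)"
  using assms by (intro is_isoI[of _ "Dom C f" "Cod C g" "inv_arr C f \<cdot> inv_arr C g"])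
    (auto simp: hom_iff)

lemma iso_cancel_left:
  assumes "is_iso C k" "k \<cdot> f = k \<cdot> g"
    and "f \<in> Arr C" "g \<in> Arr C" "Cod C f = Dom C k" "Cod C g = Dom C k"
  shows "f = g"
  using assms inv_arr_cancel(1) by metis

lemma iso_cancel_right:
  assumes "is_iso C k" "f \<cdot> k = g \<cdot> k"
    and "f \<in> Arr C" "g \<in> Arr C" "Dom C f = Cod C k" "Dom C g = Cod C k"
  shows "f = g"
proof -
  have "(f \<cdot> k) \<cdot> inv_arr C k = (g \<cdot> k) \<cdot> inv_arr C k"
    by (simp only: assms(2))
  then show ?thesis
    using assms(1,3-) by simp
qed

end


section \<open>Coherence of the units\<close>

context monoidal_category
begin

declare tensor_obj [simp] unit_obj [simp] assoc_iso [simp] lunit_iso [simp] runit_iso [simp]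
  tensor_id [simp]

lemma tensor_arr [simp]:
  assumes "f \<in> Arr C" "g \<in> Arr C"
  shows "f \<otimes> g \<in> Arr C" "Dom C (f \<otimes> g) = Dom C f \<odot> Dom C g"
    "Cod C (f \<otimes> g) = Cod C f \<odot> Cod C g"
  using tensor_hom[of f "Dom C f" "Cod C f" g "Dom C g" "Cod C g"] assms
  by (simp_all add: hom_iff)

lemma structure_arr [simp]:
  assumes "X \<in> Obj C"
  shows "Dom C (\<l> X) = \<I> \<odot> X" "Cod C (\<l> X) = X" "Dom C (\<r> X) = X \<odot> \<I>" "Cod C (\<r> X) = X"
    "\<lbrakk>Y \<in> Obj C; Z \<in> Obj C\<rbrakk> \<Longrightarrow> Dom C (\<a> X Y Z) = (X \<odot> Y) \<odot> Z"
    "\<lbrakk>Y \<in> Obj C; Z \<in> Obj C\<rbrakk> \<Longrightarrow> Cod C (\<a> X Y Z) = X \<odot> (Y \<odot> Z)"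
  using assms lunit_hom[of X] runit_hom[of X] assoc_hom[of X Y Z] by (simp_all add: hom_iff)

lemma tensor_comp [simp]:
  assumes "f \<in> Arr C" "g \<in> Arr C" "f' \<in> Arr C" "g' \<in> Arr C"
    and "Cod C f = Dom C g" "Cod C f' = Dom C g'"
  shows "(g \<otimes> g') \<cdot> (f \<otimes> f') = (g \<cdot> f) \<otimes> (g' \<cdot> f')"
  using assms by (intro interchange) (auto simp: hom_iff)

lemma tensor_comp_assoc [simp]:
  assumes "f \<in> Arr C" "g \<in> Arr C" "f' \<in> Arr C" "g' \<in> Arr C"
    and "Cod C f = Dom C g" "Cod C f' = Dom C g'"
    and "h \<in> Arr C" "Cod C h = Dom C f \<odot> Dom C f'"
  shows "(g \<otimes> g') \<cdot> ((f \<otimes> f') \<cdot> h) = ((g \<cdot> f) \<otimes> (g' \<cdot> f')) \<cdot> h"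
  using assms by (simp flip: assoc_comp)

lemma is_iso_tensor [simp]:
  assumes "is_iso C f" "is_iso C g"
  shows "is_iso C (f \<otimes> g)"
  using assms by (intro is_isoI[of _ "Dom C f \<odot> Dom C g" "Cod C f \<odot> Cod C g"
        "inv_arr C f \<otimes> inv_arr C g"]) (auto simp: hom_iff)

lemma assoc_nat:
  assumes "f \<in> Arr C" "g \<in> Arr C" "h \<in> Arr C"
    and "Dom C f = X" "Dom C g = Y" "Dom C h = Z" "Cod C f = X'" "Cod C g = Y'" "Cod C h = Z'"
  shows "\<a> X' Y' Z' \<cdot> ((f \<otimes> g) \<otimes> h) = (f \<otimes> (g \<otimes> h)) \<cdot> \<a> X Y Z"
  using assms by (intro assoc_natural) (auto simp: hom_iff)

lemma inv_assoc_nat: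
  assumes "f \<in> Arr C" "g \<in> Arr C" "h \<in> Arr C"
    and "Dom C f = X" "Dom C g = Y" "Dom C h = Z" "Cod C f = X'" "Cod C g = Y'" "Cod C h = Z'"
  shows "((f \<otimes> g) \<otimes> h) \<cdot> inv_arr C (\<a> X Y Z) = inv_arr C (\<a> X' Y' Z') \<cdot> (f \<otimes> (g \<otimes> h))"
proof -
  have obj: "X \<in> Obj C" "Y \<in> Obj C" "Z \<in> Obj C" "X' \<in> Obj C" "Y' \<in> Obj C" "Z' \<in> Obj C"
    using assms by auto
  show ?thesis
  proof (rule iso_cancel_left[of "\<a> X' Y' Z'"])
    have "\<a> X' Y' Z' \<cdot> ((f \<otimes> g) \<otimes> h) \<cdot> inv_arr C (\<a> X Y Z)
        = (\<a> X' Y' Z' \<cdot> ((f \<otimes> g) \<otimes> h)) \<cdot> inv_arr C (\<a> X Y Z)"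
      using assms(1-3) obj by (simp add: assms(4-9))
    also have "\<dots> = f \<otimes> (g \<otimes> h)"
      unfolding assoc_nat[OF assms] using assms(1-3) obj by (simp add: assms(4-9))
    finally show "\<a> X' Y' Z' \<cdot> ((f \<otimes> g) \<otimes> h) \<cdot> inv_arr C (\<a> X Y Z)
        = \<a> X' Y' Z' \<cdot> inv_arr C (\<a> X' Y' Z') \<cdot> (f \<otimes> (g \<otimes> h))"
      using assms(1-3) obj by (simp add: assms(4-9))
  qed (use assms(1-3) obj in \<open>simp_all add: assms(4-9)\<close>)
qed

lemma lunit_nat: "f \<in> Arr C \<Longrightarrow> \<l> (Cod C f) \<cdot> (\<one> \<I> \<otimes> f) = f \<cdot> \<l> (Dom C f)"
  by (intro lunit_natural) (simp add: hom_iff)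

lemma tensor_unit_left_faithful:
  assumes "\<one> \<I> \<otimes> f = \<one> \<I> \<otimes> g" "f \<in> hom X Y" "g \<in> hom X Y"
  shows "f = g"
proof (rule iso_cancel_right)
  show "f \<cdot> \<l> X = g \<cdot> \<l> X"
    using lunit_natural[OF assms(2)] lunit_natural[OF assms(3)] assms(1) by simp
qed (use assms(2,3) in \<open>auto simp: hom_iff\<close>)

lemma tensor_unit_right_faithful:
  assumes "f \<otimes> \<one> \<I> = g \<otimes> \<one> \<I>" "f \<in> hom X Y" "g \<in> hom X Y"
  shows "f = g"
proof (rule iso_cancel_right)
  show "f \<cdot> \<r> X = g \<cdot> \<r> X"
    using runit_natural[OF assms(2)] runit_natural[OF assms(3)] assms(1) by simp
qed (use assms(2,3) in \<open>auto simp: hom_iff\<close>)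

text \<open>
  Kelly's consequence of the pentagon and the triangle.  As \<open>1\<^sub>I \<otimes> -\<close> is faithful, the equation may
  be tensored with \<open>I\<close> on the left; there the pentagon for \<open>I, I, X, Y\<close> and two triangles give it.
\<close>

lemma lunit_tensor:
  assumes [simp]: "X \<in> Obj C" "Y \<in> Obj C"
  shows "\<l> (X \<odot> Y) \<cdot> \<a> \<I> X Y = \<l> X \<otimes> \<one> Y"
proof (rule tensor_unit_left_faithful[where X = "(\<I> \<odot> X) \<odot> Y" and Y = "X \<odot> Y"])
  let ?k = "\<a> \<I> (\<I> \<odot> X) Y \<cdot> (\<a> \<I> \<I> X \<otimes> \<one> Y)"
  have "(\<one> \<I> \<otimes> \<l> (X \<odot> Y)) \<cdot> (\<one> \<I> \<otimes> \<a> \<I> X Y) \<cdot> ?k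
      = (\<one> \<I> \<otimes> \<l> (X \<odot> Y)) \<cdot> \<a> \<I> \<I> (X \<odot> Y) \<cdot> \<a> (\<I> \<odot> \<I>) X Y"
    by (subst pentagon) auto
  also have "\<dots> = ((\<one> \<I> \<otimes> \<l> (X \<odot> Y)) \<cdot> \<a> \<I> \<I> (X \<odot> Y)) \<cdot> \<a> (\<I> \<odot> \<I>) X Y"
    by simp
  also have "\<dots> = (\<r> \<I> \<otimes> (\<one> X \<otimes> \<one> Y)) \<cdot> \<a> (\<I> \<odot> \<I>) X Y"
    by (subst triangle) auto
  also have "\<dots> = \<a> \<I> X Y \<cdot> ((\<r> \<I> \<otimes> \<one> X) \<otimes> \<one> Y)"
    by (rule assoc_nat[symmetric]) auto
  also have "\<dots> = \<a> \<I> X Y \<cdot> ((\<one> \<I> \<otimes> \<l> X) \<otimes> \<one> Y) \<cdot> (\<a> \<I> \<I> X \<otimes> \<one> Y)"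
    by (simp add: triangle)
  also have "\<dots> = (\<a> \<I> X Y \<cdot> ((\<one> \<I> \<otimes> \<l> X) \<otimes> \<one> Y)) \<cdot> (\<a> \<I> \<I> X \<otimes> \<one> Y)"
    by (subst assoc_comp) auto
  also have "\<dots> = (\<one> \<I> \<otimes> (\<l> X \<otimes> \<one> Y)) \<cdot> ?k"
    by (subst assoc_nat[where X = \<I> and Y = "\<I> \<odot> X" and Z = Y]) auto
  finally show "\<one> \<I> \<otimes> (\<l> (X \<odot> Y) \<cdot> \<a> \<I> X Y) = \<one> \<I> \<otimes> (\<l> X \<otimes> \<one> Y)"
    by - (rule iso_cancel_right[of ?k], auto)
qed (auto simp: hom_iff)

end

context braided_monoidal_category
begin

declare braid_iso [simp]

lemma braid_arr [simp]:
  assumes "X \<in> Obj C" "Y \<in> Obj C"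
  shows "Dom C (\<b> X Y) = X \<odot> Y" "Cod C (\<b> X Y) = Y \<odot> X"
  using braid_hom[OF assms] by (simp_all add: hom_iff)

lemma braid_nat:
  assumes "f \<in> Arr C" "g \<in> Arr C"
    and "Dom C f = X" "Dom C g = Y" "Cod C f = X'" "Cod C g = Y'"
  shows "\<b> X' Y' \<cdot> (f \<otimes> g) = (g \<otimes> f) \<cdot> \<b> X Y"
  using assms by (intro braid_natural) (auto simp: hom_iff)

text \<open>
  Compose the hexagon for \<open>V, I, I\<close> with \<open>\<l> (I \<odot> V)\<close>.  By \<open>lunit_tensor\<close>, the triangle and the
  naturality of the braiding and of \<open>\<l>\<close> it becomes the equation tensored with \<open>I\<close> on the right and
  composed with the invertible \<open>\<b> V I\<close>; and \<open>- \<otimes> 1\<^sub>I\<close> is faithful.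
\<close>

lemma lunit_braid:
  assumes [simp]: "V \<in> Obj C"
  shows "\<l> V \<cdot> \<b> V \<I> = \<r> V"
proof (rule tensor_unit_right_faithful[where X = "V \<odot> \<I>" and Y = V])
  let ?c = "\<b> V \<I>"
  have "?c \<cdot> (\<r> V \<otimes> \<one> \<I>) = ?c \<cdot> (\<one> V \<otimes> \<l> \<I>) \<cdot> \<a> V \<I> \<I>"
    by (simp only: triangle assms unit_obj)
  also have "\<dots> = (?c \<cdot> (\<one> V \<otimes> \<l> \<I>)) \<cdot> \<a> V \<I> \<I>"
    by simp
  also have "\<dots> = ((\<l> \<I> \<otimes> \<one> V) \<cdot> \<b> V (\<I> \<odot> \<I>)) \<cdot> \<a> V \<I> \<I>"
    by (subst braid_nat[where X = V and Y = "\<I> \<odot> \<I>"]) auto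
  also have "\<dots> = \<l> (\<I> \<odot> V) \<cdot> \<a> \<I> \<I> V \<cdot> \<b> V (\<I> \<odot> \<I>) \<cdot> \<a> V \<I> \<I>"
    by (subst lunit_tensor[symmetric]) auto
  also have "\<dots> = \<l> (\<I> \<odot> V) \<cdot> (\<one> \<I> \<otimes> ?c) \<cdot> \<a> \<I> V \<I> \<cdot> (?c \<otimes> \<one> \<I>)"
    by (simp only: hexagon1 assms unit_obj)
  also have "\<dots> = (\<l> (\<I> \<odot> V) \<cdot> (\<one> \<I> \<otimes> ?c)) \<cdot> \<a> \<I> V \<I> \<cdot> (?c \<otimes> \<one> \<I>)"
    by simp
  also have "\<dots> = (?c \<cdot> \<l> (V \<odot> \<I>)) \<cdot> \<a> \<I> V \<I> \<cdot> (?c \<otimes> \<one> \<I>)"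
    using lunit_nat[of ?c] by simp
  also have "\<dots> = ?c \<cdot> (\<l> (V \<odot> \<I>) \<cdot> \<a> \<I> V \<I>) \<cdot> (?c \<otimes> \<one> \<I>)"
    by simp
  also have "\<dots> = ?c \<cdot> ((\<l> V \<cdot> ?c) \<otimes> \<one> \<I>)"
    by (subst lunit_tensor) auto
  finally show "(\<l> V \<cdot> ?c) \<otimes> \<one> \<I> = \<r> V \<otimes> \<one> \<I>"
    by - (rule iso_cancel_left[of ?c], auto)
qed (auto simp: hom_iff)

end


section \<open>Operators and their intertwiners\<close>

locale braided_with_object = braided_monoidal_category C
  for C (structure) +
  fixes A
  assumes A_obj [simp]: "A \<in> Obj C"
begin

text \<open>
  No comodule equation is imposed, so that the factors \<open>v\<^sub>1\<^sub>3\<close> and \<open>w\<^sub>2\<^sub>3\<close> of a tensor product, the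
  fusion morphism \<open>t\<close> and the arrow \<open>v \<otimes> 1\<close> are operators as well.
\<close>

definition operator where
  "operator V v \<longleftrightarrow> V \<in> Obj C \<and> v \<in> hom (V \<odot> A) (V \<odot> A)"

definition intertwines where
  "intertwines V v W w f \<longleftrightarrow> operator V v \<and> operator W w \<and> f \<in> hom V W \<and>
     w \<cdot> (f \<otimes> \<one> A) = (f \<otimes> \<one> A) \<cdot> v"

lemma operatorD:
  assumes "operator V v"
  shows "V \<in> Obj C" "v \<in> Arr C" "Dom C v = V \<odot> A" "Cod C v = V \<odot> A"
  using assms by (simp_all add: operator_def hom_iff)

lemma operatorI:
  "\<lbrakk>V \<in> Obj C; v \<in> Arr C; Dom C v = V \<odot> A; Cod C v = V \<odot> A\<rbrakk> \<Longrightarrow> operator V v"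
  by (simp add: operator_def hom_iff)

lemma operator_comp [simp]:
  assumes v: "operator V v" and v': "operator V v'"
  shows "operator V (v \<cdot> v')"
  using operatorD[OF v] operatorD[OF v'] by (intro operatorI) simp_all

lemma operator_id [simp]: "V \<in> Obj C \<Longrightarrow> operator V (\<one> (V \<odot> A))"
  by (rule operatorI) simp_all

lemma intertwinesI:
  assumes "operator V v" "operator W w" "f \<in> Arr C" "Dom C f = V" "Cod C f = W"
    and "w \<cdot> (f \<otimes> \<one> A) = (f \<otimes> \<one> A) \<cdot> v"
  shows "intertwines V v W w f"
  using assms by (simp add: intertwines_def hom_iff)

lemma intertwinesD:
  assumes "intertwines V v W w f"
  shows "operator V v" "operator W w" "f \<in> Arr C" "Dom C f = V" "Cod C f = W"
    "w \<cdot> (f \<otimes> \<one> A) = (f \<otimes> \<one> A) \<cdot> v"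
  using assms by (simp_all add: intertwines_def hom_iff)

lemma intertwines_hom: "intertwines V v W w f \<Longrightarrow> f \<in> hom V W"
  by (simp add: intertwines_def)

lemma intertwines_simps:
  assumes "intertwines V v W w f"
  shows "operator V v" "operator W w" "f \<in> Arr C" "Dom C f = V" "Cod C f = W"
    "V \<in> Obj C" "v \<in> Arr C" "Dom C v = V \<odot> A" "Cod C v = V \<odot> A"
    "W \<in> Obj C" "w \<in> Arr C" "Dom C w = W \<odot> A" "Cod C w = W \<odot> A"
  using intertwinesD(1-5)[OF assms] operatorD[OF intertwinesD(1)[OF assms]]
    operatorD[OF intertwinesD(2)[OF assms]] by simp_all

lemma intertwines_id: "operator V v \<Longrightarrow> intertwines V v V v (\<one> V)"
  by (rule intertwinesI) (simp_all add: operatorD)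

lemma intertwines_comp:
  assumes f: "intertwines V v W w f" and g: "intertwines W w U u g"
  shows "intertwines V v U u (g \<cdot> f)"
proof (rule intertwinesI)
  note [simp] = intertwines_simps[OF f] intertwines_simps[OF g]
  have "u \<cdot> ((g \<cdot> f) \<otimes> \<one> A) = (u \<cdot> (g \<otimes> \<one> A)) \<cdot> (f \<otimes> \<one> A)"
    by simp
  also have "\<dots> = (g \<otimes> \<one> A) \<cdot> (w \<cdot> (f \<otimes> \<one> A))"
    by (simp only: intertwinesD(6)[OF g]) simp
  also have "\<dots> = ((g \<cdot> f) \<otimes> \<one> A) \<cdot> v"
    by (simp only: intertwinesD(6)[OF f]) simp
  finally show "u \<cdot> ((g \<cdot> f) \<otimes> \<one> A) = ((g \<cdot> f) \<otimes> \<one> A) \<cdot> v" .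
qed (use intertwines_simps[OF f] intertwines_simps[OF g] in simp_all)

lemma intertwines_inv:
  assumes f: "intertwines V v W w f" and iso [simp]: "is_iso C f"
  shows "intertwines W w V v (inv_arr C f)"
proof (rule intertwinesI)
  note [simp] = intertwines_simps[OF f]
  show "v \<cdot> (inv_arr C f \<otimes> \<one> A) = (inv_arr C f \<otimes> \<one> A) \<cdot> w"
  proof (rule iso_cancel_left[of "f \<otimes> \<one> A"])
    have "(f \<otimes> \<one> A) \<cdot> (v \<cdot> (inv_arr C f \<otimes> \<one> A)) = ((f \<otimes> \<one> A) \<cdot> v) \<cdot> (inv_arr C f \<otimes> \<one> A)"
      by simp
    also have "\<dots> = w"
      by (simp flip: intertwinesD(6)[OF f])
    finally show "(f \<otimes> \<one> A) \<cdot> (v \<cdot> (inv_arr C f \<otimes> \<one> A)) = (f \<otimes> \<one> A) \<cdot> (inv_arr C f \<otimes> \<one> A) \<cdot> w"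
      by simp
  qed simp_all
qed (use intertwines_simps[OF f] in simp_all)

text \<open>
  Used to recognise a structure arrow \<open>f\<close> as an intertwiner when only the composite \<open>m \<cdot> f\<close>, which
  a coherence axiom rewrites, splits into known intertwiners.
\<close>

lemma intertwines_cancel:
  assumes mf: "intertwines S s U u (m \<cdot> f)" and m: "intertwines T r U u m"
    and iso: "is_iso C m" and f: "f \<in> hom S T"
  shows "intertwines S s T r f"
proof -
  have "intertwines S s T r (inv_arr C m \<cdot> (m \<cdot> f))"
    by (rule intertwines_comp[OF mf intertwines_inv[OF m iso]])
  then show ?thesis
    using iso f intertwines_simps[OF m] by (simp add: hom_iff)
qed

lemma intertwines_prod:
  assumes f: "intertwines V v W w f" and f': "intertwines V v' W w' f"
  shows "intertwines V (v \<cdot> v') W (w \<cdot> w') f"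
proof (rule intertwinesI)
  note [simp] = intertwines_simps[OF f] intertwines_simps[OF f']
  have "(w \<cdot> w') \<cdot> (f \<otimes> \<one> A) = w \<cdot> (w' \<cdot> (f \<otimes> \<one> A))"
    by simp
  also have "\<dots> = (w \<cdot> (f \<otimes> \<one> A)) \<cdot> v'"
    by (simp only: intertwinesD(6)[OF f']) simp
  also have "\<dots> = (f \<otimes> \<one> A) \<cdot> (v \<cdot> v')"
    by (simp only: intertwinesD(6)[OF f]) simp
  finally show "(w \<cdot> w') \<cdot> (f \<otimes> \<one> A) = (f \<otimes> \<one> A) \<cdot> (v \<cdot> v')" .
qed (use intertwines_simps[OF f] intertwines_simps[OF f'] in simp_all)

text \<open>
  The main device for proving equations between operators: an operator is determined by the
  operator to which an isomorphism carries it.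
\<close>

lemma intertwines_unique:
  assumes f: "intertwines V v W w f" and f': "intertwines V v' W w f" and iso [simp]: "is_iso C f"
  shows "v = v'"
proof (rule iso_cancel_left[of "f \<otimes> \<one> A"])
  show "f \<otimes> \<one> A \<cdot> v = f \<otimes> \<one> A \<cdot> v'"
    using intertwinesD(6)[OF f] intertwinesD(6)[OF f'] by simp
qed (use intertwines_simps[OF f] intertwines_simps[OF f'] in simp_all)


section \<open>Adding a strand\<close>

text \<open>
  In index notation \<open>before W V v\<close> is \<open>v\<^sub>2\<^sub>3\<close> on \<open>W \<otimes> V \<otimes> A\<close>, and \<open>past X V v\<close> below is \<open>v\<^sub>1\<^sub>3\<close> on
  \<open>V \<otimes> X \<otimes> A\<close>.
\<close>

abbreviation before where
  "before W V v \<equiv> whisker_left C W V A v"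

definition past where
  "past X V v = (inv_arr C (\<b> V X) \<otimes> \<one> A) \<cdot> before X V v \<cdot> (\<b> V X \<otimes> \<one> A)"

lemma operator_before [simp]:
  assumes "W \<in> Obj C" and v: "operator V v"
  shows "operator (W \<odot> V) (before W V v)"
  using assms operatorD[OF v] by (intro operatorI) (simp_all add: whisker_left_def)

lemmas before_arr [simp] = operatorD(2-4)[OF operator_before]

lemma operator_past [simp]:
  assumes "X \<in> Obj C" and v: "operator V v"
  shows "operator (V \<odot> X) (past X V v)"
  using assms operatorD[OF v] by (intro operatorI) (simp_all add: past_def)

lemmas past_arr [simp] = operatorD(2-4)[OF operator_past]

lemma before_comp:
  assumes "W \<in> Obj C" and v: "operator V v" and v': "operator V v'"
  shows "before W V (v \<cdot> v') = before W V v \<cdot> before W V v'"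
  using assms operatorD[OF v] operatorD[OF v'] by (simp add: whisker_left_def)

lemma past_comp:
  assumes "X \<in> Obj C" and v: "operator V v" and v': "operator V v'"
  shows "past X V (v \<cdot> v') = past X V v \<cdot> past X V v'"
  using assms operatorD[OF v] operatorD[OF v']
  by (simp add: past_def before_comp)

lemma before_id: "\<lbrakk>W \<in> Obj C; V \<in> Obj C\<rbrakk> \<Longrightarrow> before W V (\<one> (V \<odot> A)) = \<one> ((W \<odot> V) \<odot> A)"
  by (simp add: whisker_left_def)

lemma past_id: "\<lbrakk>X \<in> Obj C; V \<in> Obj C\<rbrakk> \<Longrightarrow> past X V (\<one> (V \<odot> A)) = \<one> ((V \<odot> X) \<odot> A)"
  by (simp add: past_def before_id)

lemma intertwines_before:
  assumes f: "intertwines V v V' v' f" and g: "g \<in> hom W W'"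
  shows "intertwines (W \<odot> V) (before W V v) (W' \<odot> V') (before W' V' v') (g \<otimes> f)"
proof -
  note [simp] = intertwines_simps[OF f]
  have [simp]: "g \<in> Arr C" "Dom C g = W" "Cod C g = W'" "W \<in> Obj C" "W' \<in> Obj C"
    using g by (auto simp: hom_iff)
  show ?thesis
  proof (rule intertwinesI)
    have "before W' V' v' \<cdot> ((g \<otimes> f) \<otimes> \<one> A)
        = inv_arr C (\<a> W' V' A) \<cdot> (\<one> W' \<otimes> v') \<cdot> (\<a> W' V' A \<cdot> ((g \<otimes> f) \<otimes> \<one> A))"
      by (simp add: whisker_left_def)
    also have "\<dots> = inv_arr C (\<a> W' V' A) \<cdot> (g \<otimes> (v' \<cdot> (f \<otimes> \<one> A))) \<cdot> \<a> W V A"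
      by (subst assoc_nat[where X = W and Y = V and Z = A]) simp_all
    also have "\<dots> = (inv_arr C (\<a> W' V' A) \<cdot> (g \<otimes> (f \<otimes> \<one> A))) \<cdot> (\<one> W \<otimes> v) \<cdot> \<a> W V A"
      by (simp add: intertwinesD(6)[OF f])
    also have "\<dots> = (((g \<otimes> f) \<otimes> \<one> A) \<cdot> inv_arr C (\<a> W V A)) \<cdot> (\<one> W \<otimes> v) \<cdot> \<a> W V A"
      by (subst inv_assoc_nat[where X' = W' and Y' = V' and Z' = A]) simp_all
    also have "\<dots> = ((g \<otimes> f) \<otimes> \<one> A) \<cdot> before W V v"
      by (simp add: whisker_left_def)
    finally show "before W' V' v' \<cdot> ((g \<otimes> f) \<otimes> \<one> A) = ((g \<otimes> f) \<otimes> \<one> A) \<cdot> before W V v" .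
  qed simp_all
qed

text \<open>
  Both \<open>1 \<otimes> v\<close> and \<open>1 \<otimes> (1 \<otimes> v)\<close> are compared on \<open>W \<otimes> (X \<otimes> (V \<otimes> A))\<close>; the two ways of
  reaching this bracketing are the sides of the pentagon.
\<close>

lemma before_before:
  assumes [simp]: "W \<in> Obj C" "X \<in> Obj C" and v [simp]: "operator V v"
  shows "intertwines ((W \<odot> X) \<odot> V) (before (W \<odot> X) V v)
           (W \<odot> (X \<odot> V)) (before W (X \<odot> V) (before X V v)) (\<a> W X V)"
proof (rule intertwinesI)
  note [simp] = operatorD[OF v]
  let ?p = "(\<one> W \<otimes> \<a> X V A) \<cdot> \<a> W (X \<odot> V) A"
  show "before W (X \<odot> V) (before X V v) \<cdot> (\<a> W X V \<otimes> \<one> A)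
      = (\<a> W X V \<otimes> \<one> A) \<cdot> before (W \<odot> X) V v"
  proof (rule iso_cancel_left[of ?p])
    have p: "?p \<cdot> (\<a> W X V \<otimes> \<one> A) = \<a> W X (V \<odot> A) \<cdot> \<a> (W \<odot> X) V A"
      by (subst pentagon[symmetric]) simp_all
    have "?p \<cdot> before W (X \<odot> V) (before X V v) \<cdot> (\<a> W X V \<otimes> \<one> A)
        = (\<one> W \<otimes> (\<one> X \<otimes> v)) \<cdot> (?p \<cdot> (\<a> W X V \<otimes> \<one> A))"
      by (simp add: whisker_left_def)
    also have "\<dots> = ((\<one> W \<otimes> (\<one> X \<otimes> v)) \<cdot> \<a> W X (V \<odot> A)) \<cdot> \<a> (W \<odot> X) V A"
      unfolding p by simp
    also have "\<dots> = (\<a> W X (V \<odot> A) \<cdot> ((\<one> W \<otimes> \<one> X) \<otimes> v)) \<cdot> \<a> (W \<odot> X) V A"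
      by (subst assoc_nat[where X = W and Y = X and Z = "V \<odot> A"]) simp_all
    also have "\<dots> = (\<a> W X (V \<odot> A) \<cdot> \<a> (W \<odot> X) V A) \<cdot> before (W \<odot> X) V v"
      by (simp add: whisker_left_def)
    also have "\<dots> = ?p \<cdot> (\<a> W X V \<otimes> \<one> A) \<cdot> before (W \<odot> X) V v"
      unfolding p[symmetric] by (simp add: whisker_left_def)
    finally show "?p \<cdot> before W (X \<odot> V) (before X V v) \<cdot> (\<a> W X V \<otimes> \<one> A)
        = ?p \<cdot> (\<a> W X V \<otimes> \<one> A) \<cdot> before (W \<odot> X) V v" .
  qed (simp_all add: whisker_left_def)
qed (simp_all add: operatorD[OF v])

text \<open>
  By \<open>intertwines_unique\<close> this property characterises \<open>past X V v\<close>; naturality and the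
  compatibility with the associators are transported along this isomorphism.
\<close>

lemma past_braid:
  assumes [simp]: "X \<in> Obj C" and v [simp]: "operator V v"
  shows "intertwines (V \<odot> X) (past X V v) (X \<odot> V) (before X V v) (\<b> V X)"
  using operatorD[OF v] operator_past[OF assms] by (intro intertwinesI) (simp_all add: past_def)

lemma intertwines_past:
  assumes f: "intertwines V v V' v' f" and g: "g \<in> hom X X'"
  shows "intertwines (V \<odot> X) (past X V v) (V' \<odot> X') (past X' V' v') (f \<otimes> g)"
proof -
  note [simp] = intertwines_simps[OF f]
  have [simp]: "g \<in> Arr C" "Dom C g = X" "Cod C g = X'" "X \<in> Obj C" "X' \<in> Obj C"
    using g by (auto simp: hom_iff)
  show ?thesis
  proof (rule intertwines_cancel)
    have "intertwines (V \<odot> X) (past X V v) (X' \<odot> V') (before X' V' v') ((g \<otimes> f) \<cdot> \<b> V X)"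
      by (rule intertwines_comp[OF past_braid intertwines_before[OF f g]]) simp_all
    then show "intertwines (V \<odot> X) (past X V v) (X' \<odot> V') (before X' V' v') (\<b> V' X' \<cdot> (f \<otimes> g))"
      by (subst braid_nat[where X = V and Y = X]) simp_all
    show "intertwines (V' \<odot> X') (past X' V' v') (X' \<odot> V') (before X' V' v') (\<b> V' X')"
      by (rule past_braid) simp_all
  qed (simp_all add: hom_iff)
qed

text \<open>
  Move \<open>X\<close> to the far left by the braiding, where \<open>before_before\<close> applies.  The second hexagon
  identifies moving \<open>X\<close> past \<open>V \<otimes> W\<close> at once with moving it past \<open>W\<close> and then past \<open>V\<close>.
\<close>

lemma past_before:
  assumes [simp]: "V \<in> Obj C" "X \<in> Obj C" and w [simp]: "operator W w"
  shows "intertwines ((V \<odot> W) \<odot> X) (past X (V \<odot> W) (before V W w))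
           (V \<odot> (W \<odot> X)) (before V (W \<odot> X) (past X W w)) (\<a> V W X)"
proof (rule intertwines_cancel)
  note [simp] = operatorD[OF w]
  let ?m = "(\<b> V X \<otimes> \<one> W) \<cdot> inv_arr C (\<a> V X W) \<cdot> (\<one> V \<otimes> \<b> W X)"
  have "?m \<cdot> \<a> V W X = (inv_arr C (\<a> X V W) \<cdot> \<b> (V \<odot> W) X \<cdot> inv_arr C (\<a> V W X)) \<cdot> \<a> V W X"
    by (subst hexagon2) simp_all
  then have k: "?m \<cdot> \<a> V W X = inv_arr C (\<a> X V W) \<cdot> \<b> (V \<odot> W) X"
    by simp
  have "intertwines ((V \<odot> W) \<odot> X) (past X (V \<odot> W) (before V W w))
      (X \<odot> (V \<odot> W)) (before X (V \<odot> W) (before V W w)) (\<b> (V \<odot> W) X)"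
    by (intro past_braid operator_before) simp_all
  moreover have "intertwines (X \<odot> (V \<odot> W)) (before X (V \<odot> W) (before V W w))
      ((X \<odot> V) \<odot> W) (before (X \<odot> V) W w) (inv_arr C (\<a> X V W))"
    by (intro intertwines_inv before_before) simp_all
  ultimately show "intertwines ((V \<odot> W) \<odot> X) (past X (V \<odot> W) (before V W w))
      ((X \<odot> V) \<odot> W) (before (X \<odot> V) W w) (?m \<cdot> \<a> V W X)"
    unfolding k by (rule intertwines_comp)
  have "intertwines (V \<odot> (W \<odot> X)) (before V (W \<odot> X) (past X W w))
      (V \<odot> (X \<odot> W)) (before V (X \<odot> W) (before X W w)) (\<one> V \<otimes> \<b> W X)"
    by (intro intertwines_before past_braid id_hom) simp_all
  moreover have "intertwines (V \<odot> (X \<odot> W)) (before V (X \<odot> W) (before X W w))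
      ((V \<odot> X) \<odot> W) (before (V \<odot> X) W w) (inv_arr C (\<a> V X W))"
    by (intro intertwines_inv before_before) simp_all
  moreover have "intertwines ((V \<odot> X) \<odot> W) (before (V \<odot> X) W w)
      ((X \<odot> V) \<odot> W) (before (X \<odot> V) W w) (\<b> V X \<otimes> \<one> W)"
    by (intro intertwines_before intertwines_id braid_hom) simp_all
  ultimately show "intertwines (V \<odot> (W \<odot> X)) (before V (W \<odot> X) (past X W w))
      ((X \<odot> V) \<odot> W) (before (X \<odot> V) W w) ?m"
    by (intro intertwines_comp[OF intertwines_comp]) simp_all
  show "is_iso C ?m"
    by simp
  show "\<a> V W X \<in> hom ((V \<odot> W) \<odot> X) (V \<odot> (W \<odot> X))"
    by (rule assoc_hom) simp_all
qed

text \<open>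
  Move \<open>V\<close> to the far right, past \<open>W\<close> and then past \<open>X\<close>, which by the first hexagon is moving it
  past \<open>W \<otimes> X\<close>.  Between the two moves \<open>X\<close> stands to the right of \<open>V\<close> and \<open>W\<close> to its left, the
  situation of \<open>past_before\<close>.
\<close>

lemma past_past:
  assumes [simp]: "W \<in> Obj C" "X \<in> Obj C" and v [simp]: "operator V v"
  shows "intertwines ((V \<odot> W) \<odot> X) (past X (V \<odot> W) (past W V v))
           (V \<odot> (W \<odot> X)) (past (W \<odot> X) V v) (\<a> V W X)"
proof (rule intertwines_cancel)
  note [simp] = operatorD[OF v]
  let ?m = "\<a> W X V \<cdot> \<b> V (W \<odot> X)"
  have k: "?m \<cdot> \<a> V W X = (\<one> W \<otimes> \<b> V X) \<cdot> \<a> W V X \<cdot> (\<b> V W \<otimes> \<one> X)"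
    by (subst hexagon1[symmetric]) simp_all
  have "intertwines ((V \<odot> W) \<odot> X) (past X (V \<odot> W) (past W V v))
      ((W \<odot> V) \<odot> X) (past X (W \<odot> V) (before W V v)) (\<b> V W \<otimes> \<one> X)"
    by (intro intertwines_past past_braid id_hom) simp_all
  moreover have "intertwines ((W \<odot> V) \<odot> X) (past X (W \<odot> V) (before W V v))
      (W \<odot> (V \<odot> X)) (before W (V \<odot> X) (past X V v)) (\<a> W V X)"
    by (rule past_before) simp_all
  moreover have "intertwines (W \<odot> (V \<odot> X)) (before W (V \<odot> X) (past X V v))
      (W \<odot> (X \<odot> V)) (before W (X \<odot> V) (before X V v)) (\<one> W \<otimes> \<b> V X)"
    by (intro intertwines_before past_braid id_hom) simp_all
  ultimately show "intertwines ((V \<odot> W) \<odot> X) (past X (V \<odot> W) (past W V v))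
      (W \<odot> (X \<odot> V)) (before W (X \<odot> V) (before X V v)) (?m \<cdot> \<a> V W X)"
    unfolding k by (metis intertwines_comp)
  show "intertwines (V \<odot> (W \<odot> X)) (past (W \<odot> X) V v)
      (W \<odot> (X \<odot> V)) (before W (X \<odot> V) (before X V v)) ?m"
    by (rule intertwines_comp[OF past_braid before_before]) simp_all
  show "is_iso C ?m"
    by simp
  show "\<a> V W X \<in> hom ((V \<odot> W) \<odot> X) (V \<odot> (W \<odot> X))"
    by (rule assoc_hom) simp_all
qed


section \<open>The tensor product of operators\<close>

definition tensor_operator where
  "tensor_operator V v W w = past W V v \<cdot> before V W w"

lemma operator_tensor [simp]:
  assumes v: "operator V v" and w: "operator W w"
  shows "operator (V \<odot> W) (tensor_operator V v W w)"
  using assms operatorD[OF v] operatorD[OF w] by (simp add: tensor_operator_def)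

lemma intertwines_tensor:
  assumes f: "intertwines V v V' v' f" and g: "intertwines W w W' w' g"
  shows "intertwines (V \<odot> W) (tensor_operator V v W w) (V' \<odot> W') (tensor_operator V' v' W' w')
           (f \<otimes> g)"
  unfolding tensor_operator_def
  using intertwines_simps[OF f] intertwines_simps[OF g]
  by (intro intertwines_prod intertwines_past intertwines_before f g) (simp_all add: hom_iff)

text \<open>
  Both operators are products of three factors, in index notation \<open>v\<^sub>1\<^sub>4 w\<^sub>2\<^sub>4 x\<^sub>3\<^sub>4\<close>, and the associator
  intertwines them factor by factor.
\<close>

lemma intertwines_assoc:
  assumes v [simp]: "operator V v" and w [simp]: "operator W w" and x [simp]: "operator X x"
  shows "intertwines ((V \<odot> W) \<odot> X) (tensor_operator (V \<odot> W) (tensor_operator V v W w) X x)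
           (V \<odot> (W \<odot> X)) (tensor_operator V v (W \<odot> X) (tensor_operator W w X x)) (\<a> V W X)"
proof -
  note [simp] = operatorD[OF v] operatorD[OF w] operatorD[OF x]
  have "intertwines ((V \<odot> W) \<odot> X)
      (past X (V \<odot> W) (past W V v) \<cdot> past X (V \<odot> W) (before V W w) \<cdot> before (V \<odot> W) X x)
      (V \<odot> (W \<odot> X))
      (past (W \<odot> X) V v \<cdot> before V (W \<odot> X) (past X W w) \<cdot> before V (W \<odot> X) (before W X x))
      (\<a> V W X)"
    by (intro intertwines_prod past_past past_before before_before) simp_all
  then show ?thesis
    by (simp add: tensor_operator_def past_comp before_comp)
qed

lemma intertwines_lunit_before:
  assumes v [simp]: "operator V v"
  shows "intertwines (\<I> \<odot> V) (before \<I> V v) V v (\<l> V)"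
proof (rule intertwinesI)
  note [simp] = operatorD[OF v]
  have "v \<cdot> (\<l> V \<otimes> \<one> A) = (v \<cdot> \<l> (V \<odot> A)) \<cdot> \<a> \<I> V A"
    by (subst lunit_tensor[symmetric]) simp_all
  also have "\<dots> = (\<l> (V \<odot> A) \<cdot> (\<one> \<I> \<otimes> v)) \<cdot> \<a> \<I> V A"
    using lunit_nat[of v] by simp
  also have "\<dots> = (\<l> (V \<odot> A) \<cdot> \<a> \<I> V A) \<cdot> before \<I> V v"
    by (simp add: whisker_left_def)
  also have "\<dots> = (\<l> V \<otimes> \<one> A) \<cdot> before \<I> V v"
    by (subst lunit_tensor) simp_all
  finally show "v \<cdot> (\<l> V \<otimes> \<one> A) = (\<l> V \<otimes> \<one> A) \<cdot> before \<I> V v" .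
qed (simp_all add: operatorD[OF v])

lemma intertwines_lunit:
  assumes v [simp]: "operator V v"
  shows "intertwines (\<I> \<odot> V) (tensor_operator \<I> (\<one> (\<I> \<odot> A)) V v) V v (\<l> V)"
  using intertwines_lunit_before[OF v] operatorD[OF v]
  by (simp add: tensor_operator_def past_id)

lemma intertwines_runit:
  assumes v [simp]: "operator V v"
  shows "intertwines (V \<odot> \<I>) (tensor_operator V v \<I> (\<one> (\<I> \<odot> A))) V v (\<r> V)"
proof -
  note [simp] = operatorD[OF v]
  have "intertwines (V \<odot> \<I>) (past \<I> V v) V v (\<l> V \<cdot> \<b> V \<I>)"
    by (rule intertwines_comp[OF past_braid intertwines_lunit_before]) simp_all
  then show ?thesis
    by (simp add: tensor_operator_def before_id lunit_braid)
qed


section \<open>The fusion and counit equations\<close>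

text \<open>
  Besides \<open>v\<^sub>1\<^sub>3\<close>, the fusion equation involves \<open>v\<^sub>1\<^sub>2\<close>, which is \<open>v \<otimes> 1\<close> regarded as an operator on
  \<open>V \<otimes> A\<close>: its second factor \<open>A\<close> belongs to the object, its last one is acted on trivially.
\<close>

lemma operator_second [simp]:
  assumes v: "operator V v"
  shows "operator (V \<odot> A) (v \<otimes> \<one> A)"
  using operatorD[OF v] by (intro operatorI) simp_all

lemma intertwines_second:
  assumes f: "intertwines V v V' v' f"
  shows "intertwines (V \<odot> A) (v \<otimes> \<one> A) (V' \<odot> A) (v' \<otimes> \<one> A) (f \<otimes> \<one> A)"
  using intertwines_simps[OF f] intertwinesD(6)[OF f] by (intro intertwinesI) simp_all

lemma before_second:
  assumes [simp]: "W \<in> Obj C" and v: "operator V v"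
  shows "before W (V \<odot> A) (v \<otimes> \<one> A) = (\<one> W \<otimes> v) \<otimes> \<one> A"
proof -
  note [simp] = operatorD[OF v]
  have "before W (V \<odot> A) (v \<otimes> \<one> A)
      = inv_arr C (\<a> W (V \<odot> A) A) \<cdot> \<a> W (V \<odot> A) A \<cdot> ((\<one> W \<otimes> v) \<otimes> \<one> A)"
    unfolding whisker_left_def
    by (subst assoc_nat[where X = W and Y = "V \<odot> A" and Z = A]) simp_all
  then show ?thesis
    by simp
qed

lemma second_before:
  assumes [simp]: "W \<in> Obj C" and v [simp]: "operator V v"
  shows "intertwines ((W \<odot> V) \<odot> A) (before W V v \<otimes> \<one> A)
           (W \<odot> (V \<odot> A)) (before W (V \<odot> A) (v \<otimes> \<one> A)) (\<a> W V A)"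
proof (rule intertwinesI)
  note [simp] = operatorD[OF v]
  show "before W (V \<odot> A) (v \<otimes> \<one> A) \<cdot> (\<a> W V A \<otimes> \<one> A)
      = (\<a> W V A \<otimes> \<one> A) \<cdot> (before W V v \<otimes> \<one> A)"
    unfolding before_second[OF assms] by (simp add: whisker_left_def)
qed (simp_all add: operatorD[OF v])

text \<open>
  In index notation \<open>v\<^sub>1\<^sub>4 w\<^sub>2\<^sub>3 = w\<^sub>2\<^sub>3 v\<^sub>1\<^sub>4\<close> on \<open>V \<otimes> W \<otimes> A \<otimes> A\<close>.  After rebracketing, \<open>v\<^sub>1\<^sub>4\<close> is \<open>v\<close>
  moved past the single object \<open>W \<otimes> A\<close>, and \<open>1 \<otimes> w\<close> intertwines this operator with itself by
  \<open>intertwines_past\<close>.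
\<close>

lemma past_before_second_commute:
  assumes v [simp]: "operator V v" and w [simp]: "operator W w"
  shows "past A (V \<odot> W) (past W V v) \<cdot> (before V W w \<otimes> \<one> A)
       = (before V W w \<otimes> \<one> A) \<cdot> past A (V \<odot> W) (past W V v)"
proof (rule intertwines_unique)
  note [simp] = operatorD[OF v] operatorD[OF w]
  let ?w = "before V (W \<odot> A) (w \<otimes> \<one> A)"
  have p: "intertwines ((V \<odot> W) \<odot> A) (past A (V \<odot> W) (past W V v))
      (V \<odot> (W \<odot> A)) (past (W \<odot> A) V v) (\<a> V W A)"
    by (rule past_past) simp_all
  have b: "intertwines ((V \<odot> W) \<odot> A) (before V W w \<otimes> \<one> A) (V \<odot> (W \<odot> A)) ?w (\<a> V W A)"
    by (rule second_before) simp_all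
  have "intertwines (V \<odot> (W \<odot> A)) (past (W \<odot> A) V v)
      (V \<odot> (W \<odot> A)) (past (W \<odot> A) V v) (\<one> V \<otimes> w)"
    by (intro intertwines_past intertwines_id) (simp_all add: hom_iff)
  then have "past (W \<odot> A) V v \<cdot> ?w = ?w \<cdot> past (W \<odot> A) V v"
    using intertwinesD(6) by (simp add: before_second)
  then show "intertwines ((V \<odot> W) \<odot> A) (past A (V \<odot> W) (past W V v) \<cdot> (before V W w \<otimes> \<one> A))
      (V \<odot> (W \<odot> A)) (?w \<cdot> past (W \<odot> A) V v) (\<a> V W A)"
    using intertwines_prod[OF p b] by simp
  show "intertwines ((V \<odot> W) \<odot> A) ((before V W w \<otimes> \<one> A) \<cdot> past A (V \<odot> W) (past W V v))
      (V \<odot> (W \<odot> A)) (?w \<cdot> past (W \<odot> A) V v) (\<a> V W A)"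
    by (rule intertwines_prod[OF b p])
  show "is_iso C (\<a> V W A)"
    by simp
qed

definition fusion_equation where
  "fusion_equation t V v \<longleftrightarrow>
     (v \<otimes> \<one> A) \<cdot> past A V v \<cdot> before V A t = before V A t \<cdot> (v \<otimes> \<one> A)"

definition counit_equation where
  "counit_equation e V v \<longleftrightarrow> (\<one> V \<otimes> e) \<cdot> v = \<one> V \<otimes> e"

text \<open>
  Both sides are products of operators on \<open>V \<otimes> A\<close>, and \<open>f \<otimes> 1\<close> carries each of them to the
  corresponding operator on \<open>V' \<otimes> A\<close>.
\<close>

lemma fusion_equation_iso:
  assumes f: "intertwines V v V' v' f" and iso: "is_iso C f" and t: "operator A t"
    and fus: "fusion_equation t V' v'"
  shows "fusion_equation t V v"
  unfolding fusion_equation_def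
proof (rule intertwines_unique)
  let ?F = "f \<otimes> \<one> A"
  note [simp] = intertwines_simps[OF f]
  have 1: "intertwines (V \<odot> A) (v \<otimes> \<one> A) (V' \<odot> A) (v' \<otimes> \<one> A) ?F"
    by (rule intertwines_second[OF f])
  have 2: "intertwines (V \<odot> A) (before V A t) (V' \<odot> A) (before V' A t) ?F"
    by (intro intertwines_before intertwines_id t) (simp add: hom_iff)
  have "intertwines (V \<odot> A) (past A V v) (V' \<odot> A) (past A V' v') ?F"
    by (intro intertwines_past f id_hom) simp
  from intertwines_prod[OF 1 intertwines_prod[OF this 2]]
  show "intertwines (V \<odot> A) ((v \<otimes> \<one> A) \<cdot> past A V v \<cdot> before V A t)
      (V' \<odot> A) (before V' A t \<cdot> (v' \<otimes> \<one> A)) ?F"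
    using fus by (simp add: fusion_equation_def)
  show "intertwines (V \<odot> A) (before V A t \<cdot> (v \<otimes> \<one> A))
      (V' \<odot> A) (before V' A t \<cdot> (v' \<otimes> \<one> A)) ?F"
    by (rule intertwines_prod[OF 2 1])
  show "is_iso C ?F"
    using iso by simp
qed

text \<open>
  Rebracketing turns every operator in the equation for \<open>W \<otimes> V\<close> into \<open>1 \<otimes> -\<close> of the
  corresponding one in the equation for \<open>V\<close>.
\<close>

lemma fusion_equation_before:
  assumes [simp]: "W \<in> Obj C" and v [simp]: "operator V v" and t [simp]: "operator A t"
    and fus: "fusion_equation t V v"
  shows "fusion_equation t (W \<odot> V) (before W V v)"
  unfolding fusion_equation_def
proof (rule intertwines_unique)
  note [simp] = operatorD[OF v] operatorD[OF t]
  let ?B = "before W (V \<odot> A)"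
  have 1: "intertwines ((W \<odot> V) \<odot> A) (before W V v \<otimes> \<one> A) (W \<odot> (V \<odot> A)) (?B (v \<otimes> \<one> A)) (\<a> W V A)"
    by (rule second_before) simp_all
  have 2: "intertwines ((W \<odot> V) \<odot> A) (before (W \<odot> V) A t) (W \<odot> (V \<odot> A)) (?B (before V A t)) (\<a> W V A)"
    by (rule before_before) simp_all
  have "intertwines ((W \<odot> V) \<odot> A) (past A (W \<odot> V) (before W V v)) (W \<odot> (V \<odot> A)) (?B (past A V v)) (\<a> W V A)"
    by (rule past_before) simp_all
  from intertwines_prod[OF 1 intertwines_prod[OF this 2]]
  show "intertwines ((W \<odot> V) \<odot> A)
      ((before W V v \<otimes> \<one> A) \<cdot> past A (W \<odot> V) (before W V v) \<cdot> before (W \<odot> V) A t)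
      (W \<odot> (V \<odot> A)) (?B (before V A t \<cdot> (v \<otimes> \<one> A))) (\<a> W V A)"
    using fus unfolding fusion_equation_def by (simp flip: before_comp)
  show "intertwines ((W \<odot> V) \<odot> A) (before (W \<odot> V) A t \<cdot> (before W V v \<otimes> \<one> A))
      (W \<odot> (V \<odot> A)) (?B (before V A t \<cdot> (v \<otimes> \<one> A))) (\<a> W V A)"
    using intertwines_prod[OF 2 1] by (simp add: before_comp)
  show "is_iso C (\<a> W V A)"
    by simp
qed

lemma fusion_equation_past:
  assumes [simp]: "X \<in> Obj C" and v [simp]: "operator V v" and t [simp]: "operator A t"
    and fus: "fusion_equation t V v"
  shows "fusion_equation t (V \<odot> X) (past X V v)"
  using assms operatorD(1)[OF v]
  by (intro fusion_equation_iso[OF past_braid] fusion_equation_before) simp_all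

text \<open>
  The equation is multiplicative up to one exchange: in
  \<open>v\<^sub>1\<^sub>2 v'\<^sub>1\<^sub>2 v\<^sub>1\<^sub>3 v'\<^sub>1\<^sub>3 t\<^sub>2\<^sub>3\<close> the two middle factors have to be swapped before the equations for \<open>v'\<close>
  and then \<open>v\<close> apply.
\<close>

lemma fusion_equation_comp:
  assumes v [simp]: "operator V v" and v' [simp]: "operator V v'" and t [simp]: "operator A t"
    and fus: "fusion_equation t V v" and fus': "fusion_equation t V v'"
    and commute: "past A V v \<cdot> (v' \<otimes> \<one> A) = (v' \<otimes> \<one> A) \<cdot> past A V v"
  shows "fusion_equation t V (v \<cdot> v')"
proof -
  note [simp] = operatorD[OF v] operatorD[OF v'] operatorD[OF t]
  have "((v \<cdot> v') \<otimes> \<one> A) \<cdot> past A V (v \<cdot> v') \<cdot> before V A t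
      = (v \<otimes> \<one> A) \<cdot> ((v' \<otimes> \<one> A) \<cdot> past A V v) \<cdot> past A V v' \<cdot> before V A t"
    by (simp add: past_comp)
  also have "\<dots> = (v \<otimes> \<one> A) \<cdot> past A V v \<cdot> ((v' \<otimes> \<one> A) \<cdot> past A V v' \<cdot> before V A t)"
    unfolding commute[symmetric] by simp
  also have "\<dots> = ((v \<otimes> \<one> A) \<cdot> past A V v \<cdot> before V A t) \<cdot> (v' \<otimes> \<one> A)"
    unfolding fus'[unfolded fusion_equation_def] by simp
  also have "\<dots> = before V A t \<cdot> ((v \<cdot> v') \<otimes> \<one> A)"
    unfolding fus[unfolded fusion_equation_def] by simp
  finally show ?thesis
    unfolding fusion_equation_def .
qed

lemma fusion_equation_tensor:
  assumes v [simp]: "operator V v" and w [simp]: "operator W w" and t: "operator A t"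
    and "fusion_equation t V v" "fusion_equation t W w"
  shows "fusion_equation t (V \<odot> W) (tensor_operator V v W w)"
  unfolding tensor_operator_def
  using assms operatorD(1)[OF v] operatorD(1)[OF w]
  by (intro fusion_equation_comp fusion_equation_past fusion_equation_before
      past_before_second_commute) simp_all

text \<open>
  The arrows \<open>1\<^sub>V \<otimes> e\<close> are natural in \<open>V\<close>, so the equation may be checked after the isomorphism
  \<open>f \<otimes> 1\<^sub>I\<close>.
\<close>

lemma counit_equation_iso:
  assumes f: "intertwines V v V' v' f" and iso [simp]: "is_iso C f" and e: "e \<in> hom A \<I>"
    and counit: "counit_equation e V' v'"
  shows "counit_equation e V v"
  unfolding counit_equation_def
proof (rule iso_cancel_left[of "f \<otimes> \<one> \<I>"])
  note [simp] = intertwines_simps[OF f] e[unfolded hom_iff]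
  have "(f \<otimes> \<one> \<I>) \<cdot> (\<one> V \<otimes> e) \<cdot> v = (\<one> V' \<otimes> e) \<cdot> ((f \<otimes> \<one> A) \<cdot> v)"
    by simp
  also have "\<dots> = ((\<one> V' \<otimes> e) \<cdot> v') \<cdot> (f \<otimes> \<one> A)"
    unfolding intertwinesD(6)[OF f, symmetric] by simp
  also have "\<dots> = (f \<otimes> \<one> \<I>) \<cdot> (\<one> V \<otimes> e)"
    unfolding counit[unfolded counit_equation_def] by simp
  finally show "(f \<otimes> \<one> \<I>) \<cdot> (\<one> V \<otimes> e) \<cdot> v = (f \<otimes> \<one> \<I>) \<cdot> (\<one> V \<otimes> e)" .
qed (use intertwines_simps[OF f] e in \<open>simp_all add: hom_iff\<close>)

lemma counit_equation_before:
  assumes [simp]: "W \<in> Obj C" and v: "operator V v" and e: "e \<in> hom A \<I>"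
    and counit: "counit_equation e V v"
  shows "counit_equation e (W \<odot> V) (before W V v)"
proof -
  note [simp] = operatorD[OF v] e[unfolded hom_iff]
  have nat: "(\<one> (W \<odot> V) \<otimes> e) \<cdot> inv_arr C (\<a> W V A) = inv_arr C (\<a> W V \<I>) \<cdot> (\<one> W \<otimes> (\<one> V \<otimes> e))"
    using inv_assoc_nat[of "\<one> W" "\<one> V" e W V A W V \<I>] by simp
  have "(\<one> (W \<odot> V) \<otimes> e) \<cdot> before W V v
      = ((\<one> (W \<odot> V) \<otimes> e) \<cdot> inv_arr C (\<a> W V A)) \<cdot> (\<one> W \<otimes> v) \<cdot> \<a> W V A"
    by (simp add: whisker_left_def)
  also have "\<dots> = inv_arr C (\<a> W V \<I>) \<cdot> (\<one> W \<otimes> ((\<one> V \<otimes> e) \<cdot> v)) \<cdot> \<a> W V A"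
    unfolding nat by simp
  also have "\<dots> = (inv_arr C (\<a> W V \<I>) \<cdot> (\<one> W \<otimes> (\<one> V \<otimes> e))) \<cdot> \<a> W V A"
    unfolding counit[unfolded counit_equation_def] by simp
  also have "\<dots> = \<one> (W \<odot> V) \<otimes> e"
    unfolding nat[symmetric] by simp
  finally show ?thesis
    unfolding counit_equation_def .
qed

lemma counit_equation_tensor:
  assumes v [simp]: "operator V v" and w [simp]: "operator W w" and e: "e \<in> hom A \<I>"
    and counit: "counit_equation e V v" "counit_equation e W w"
  shows "counit_equation e (V \<odot> W) (tensor_operator V v W w)"
proof -
  note [simp] = operatorD[OF v] operatorD[OF w] e[unfolded hom_iff]
  have p: "counit_equation e (V \<odot> W) (past W V v)"
    by (rule counit_equation_iso[OF past_braid _ e counit_equation_before[OF _ v e counit(1)]])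
      simp_all
  have b: "counit_equation e (V \<odot> W) (before V W w)"
    by (rule counit_equation_before[OF _ w e counit(2)]) simp
  have "(\<one> (V \<odot> W) \<otimes> e) \<cdot> tensor_operator V v W w
      = ((\<one> (V \<odot> W) \<otimes> e) \<cdot> past W V v) \<cdot> before V W w"
    by (simp add: tensor_operator_def)
  also have "\<dots> = \<one> (V \<odot> W) \<otimes> e"
    using p b by (simp add: counit_equation_def)
  finally show ?thesis
    unfolding counit_equation_def .
qed

text \<open>
  In the definition of a comodule the factor \<open>past A V v\<close> appears expanded, bracketed with the
  arrow that follows it.
\<close>

lemma comodule_iff:
  assumes t: "operator A t"
  shows "comodule C A t e V v \<longleftrightarrow> operator V v \<and> fusion_equation t V v \<and> counit_equation e V v"
proof (cases "operator V v")
  case v: True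
  note [simp] = operatorD[OF v] operatorD[OF t]
  show ?thesis
    using v t by (simp add: comodule_def fusion_equation_def counit_equation_def operator_def
        past_def hom_iff)
next
  case False
  then show ?thesis
    by (auto simp: comodule_def operator_def)
qed

lemma comodule_unit:
  assumes t: "operator A t" and e: "e \<in> hom A \<I>"
  shows "comodule C A t e \<I> (\<one> (\<I> \<odot> A))"
  using operatorD[OF t] e t operator_before[OF _ t, of \<I>]
  by (simp add: comodule_iff fusion_equation_def counit_equation_def past_id hom_iff)

lemma comodule_tensor:
  assumes t: "operator A t" and e: "e \<in> hom A \<I>"
    and "comodule C A t e V v" "comodule C A t e W w"
  shows "comodule C A t e (V \<odot> W) (tensor_operator V v W w)"
  using assms by (simp add: comodule_iff fusion_equation_tensor counit_equation_tensor)

end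


section \<open>The monoidal category of comodules\<close>

locale counital_fusion = braided_with_object C A
  for C (structure) and A +
  fixes t e
  assumes t [simp]: "operator A t" and e [simp]: "e \<in> hom A \<I>"
begin

definition tensor_comodule where
  "tensor_comodule P Q = (fst P \<odot> fst Q, tensor_operator (fst P) (snd P) (fst Q) (snd Q))"

definition unit_comodule where
  "unit_comodule = (\<I>, \<one> (\<I> \<odot> A))"

text \<open>
  Extending the given record makes the underlying category agree with the category of comodules
  by construction.  Every arrow repeats its domain and codomain, which is why those of the structure
  isomorphisms are spelled out.
\<close>

definition comodules where
  "comodules = category.extend (comodule_category C A t e)
     (monoidal_category.fields
       tensor_comodule
       (\<lambda>(P, P', f) (Q, Q', g). (tensor_comodule P Q, tensor_comodule P' Q', f \<otimes> g))
       unit_comodule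
       (\<lambda>P Q R. (tensor_comodule (tensor_comodule P Q) R, tensor_comodule P (tensor_comodule Q R),
          \<a> (fst P) (fst Q) (fst R)))
       (\<lambda>P. (tensor_comodule unit_comodule P, P, \<l> (fst P)))
       (\<lambda>P. (tensor_comodule P unit_comodule, P, \<r> (fst P))))"

lemma comodules_simps [simp]:
  "Dom comodules (P, Q, f) = P"
  "Cod comodules (P, Q, f) = Q"
  "Id comodules P = (P, P, \<one> (fst P))"
  "Comp comodules (Q, R, g) (P, Q', f) = (P, R, g \<cdot> f)"
  "Tensor_obj comodules P Q = tensor_comodule P Q"
  "Tensor_arr comodules (P, P', f) (Q, Q', g) = (tensor_comodule P Q, tensor_comodule P' Q', f \<otimes> g)"
  "Unit comodules = unit_comodule"
  "Assoc comodules P Q R = (tensor_comodule (tensor_comodule P Q) R,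
     tensor_comodule P (tensor_comodule Q R), \<a> (fst P) (fst Q) (fst R))"
  "Lunit comodules P = (tensor_comodule unit_comodule P, P, \<l> (fst P))"
  "Runit comodules P = (tensor_comodule P unit_comodule, P, \<r> (fst P))"
  by (simp_all add: comodules_def comodule_category_def category.extend_def
      monoidal_category.fields_def)

lemma truncate_comodules: "category.truncate comodules = comodule_category C A t e"
  by (simp add: comodules_def comodule_category_def category.extend_def category.truncate_def
      monoidal_category.fields_def)

lemma obj_comodules: "P \<in> Obj comodules \<longleftrightarrow> comodule C A t e (fst P) (snd P)"
  by (simp add: comodules_def comodule_category_def category.extend_def case_prod_beta)

lemma operator_comodule [simp]: "P \<in> Obj comodules \<Longrightarrow> operator (fst P) (snd P)"
  by (simp add: obj_comodules comodule_iff)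

lemma comodule_obj [simp]: "P \<in> Obj comodules \<Longrightarrow> fst P \<in> Obj C"
  using operatorD(1) operator_comodule by blast

lemma arr_comodules:
  "(P, Q, f) \<in> Arr comodules \<longleftrightarrow> P \<in> Obj comodules \<and> Q \<in> Obj comodules \<and>
     intertwines (fst P) (snd P) (fst Q) (snd Q) f"
proof -
  have "(P, Q, f) \<in> Arr comodules \<longleftrightarrow> P \<in> Obj comodules \<and> Q \<in> Obj comodules \<and>
      comodule_morphism C A P Q f"
    by (simp add: obj_comodules)
      (simp add: comodules_def comodule_category_def category.extend_def)
  then show ?thesis
    by (auto simp: comodule_morphism_def intertwines_def)
qed

lemma hom_comodules:
  "x \<in> hom\<^bsub>comodules\<^esub> P Q \<longleftrightarrow> (\<exists>f. x = (P, Q, f) \<and> P \<in> Obj comodules \<and> Q \<in> Obj comodules \<and>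
     intertwines (fst P) (snd P) (fst Q) (snd Q) f)"
  by (cases x) (auto simp: homset_def arr_comodules)

lemma tensor_comodule_obj [simp]:
  "\<lbrakk>P \<in> Obj comodules; Q \<in> Obj comodules\<rbrakk> \<Longrightarrow> tensor_comodule P Q \<in> Obj comodules"
  by (simp add: obj_comodules tensor_comodule_def comodule_tensor)

lemma unit_comodule_obj [simp]: "unit_comodule \<in> Obj comodules"
  by (simp add: obj_comodules unit_comodule_def comodule_unit)

lemma fst_comodule [simp]:
  "fst (tensor_comodule P Q) = fst P \<odot> fst Q" "fst unit_comodule = \<I>"
  by (simp_all add: tensor_comodule_def unit_comodule_def)

lemma snd_comodule [simp]:
  "snd (tensor_comodule P Q) = tensor_operator (fst P) (snd P) (fst Q) (snd Q)"
  "snd unit_comodule = \<one> (\<I> \<odot> A)"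
  by (simp_all add: tensor_comodule_def unit_comodule_def)

lemma is_iso_comodules:
  assumes "(P, Q, f) \<in> Arr comodules" and [simp]: "is_iso C f"
  shows "is_iso comodules (P, Q, f)"
  unfolding is_iso_def
proof
  have f: "intertwines (fst P) (snd P) (fst Q) (snd Q) f"
    using assms(1) by (simp add: arr_comodules)
  show "inverse_arrows comodules (P, Q, f) (Q, P, inv_arr C f)"
    using assms(1) intertwines_inv[OF f] intertwines_simps[OF f]
    by (simp add: inverse_arrows_def hom_comodules arr_comodules)
qed

lemma category_comodules: "category comodules"
proof
qed (auto simp: hom_comodules arr_comodules intertwines_id intertwines_comp intertwines_simps)

lemma monoidal_category_comodules: "monoidal_category comodules"
proof (intro monoidal_category.intro monoidal_category_axioms.intro category_comodules)
qed (auto simp: hom_comodules arr_comodules intertwines_tensor intertwines_simps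
    intertwines_assoc intertwines_lunit intertwines_runit is_iso_comodules
    assoc_nat pentagon triangle,
    (erule lunit_natural[OF intertwines_hom] runit_natural[OF intertwines_hom])+)

lemma forget_strict_monoidal: "strict_monoidal_functor comodules C forget_obj forget_arr"
proof -
  interpret M: monoidal_category comodules by (rule monoidal_category_comodules)
  show ?thesis
    by unfold_locales
      (auto simp: hom_comodules arr_comodules forget_obj_def forget_arr_def case_prod_beta
        intertwines_simps hom_iff)
qed

end

theorem corollary2p13:
  fixes C :: "('o, 'm, 'z) braided_monoidal_category_scheme"
    and A :: 'o and t e :: 'm
  assumes "braided_monoidal_category C"
    and "counital_fusion_morphism C A t e"
  shows "\<exists>M :: ('o \<times> 'm, ('o \<times> 'm) \<times> ('o \<times> 'm) \<times> 'm) monoidal_category.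
           category.truncate M = comodule_category C A t e \<and>
           monoidal_category M \<and>
           strict_monoidal_functor M C forget_obj forget_arr"
proof -
  interpret braided_monoidal_category C by (rule assms(1))
  interpret braided_with_object C A
    using assms(2) by unfold_locales (simp add: counital_fusion_morphism_def)
  interpret counital_fusion C A t e
    using assms(2) by unfold_locales (simp_all add: counital_fusion_morphism_def operator_def)
  show ?thesis
    using truncate_comodules monoidal_category_comodules forget_strict_monoidal by blast
qed

end
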